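(* For all non-negative integers $n,m,p,q$ and all complex $z,w,\gamma$, $$H_{n,m}^{(p+1,q)}(z,w|\gamma)=n!\,m!\sum_{k=0}^{\lfloor n/p\rfloor\wedge\lfloor m/q\rfloor}\;\sum_{j=0}^{k}\binom{k}{j}\frac{\gamma^k}{k!}(-1)^{k-j}\,\frac{H_{n-j-pk,\,m-qk}^{(p,q)}(z,w|\gamma)}{(n-j-pk)!\,(m-qk)!},$$ where terms with $n-j-pk<0$ are read as $0$.
   Context: For non-negative integers $n,m,p,q$ and complex $z,w,\gamma$, $$H_{n,m}^{(p,q)}(z,w|\gamma)= n!\,m!\sum_{k=0}^{\lfloor n/p\rfloor\wedge\lfloor m/q\rfloor}\frac{\gamma^k}{k!}\frac{z^{n-pk}}{(n-pk)!}\frac{w^{m-qk}}{(m-qk)!},$$ where $a\wedge b=\min\{a,b\}$ and $\lfloor j/0\rfloor=+\infty$ by convention (so for $p=q=0$ such a sum over $k$ is an infinite series and $H_{n,m}^{(0,0)}(z,w|\gamma)=e^{\gamma}z^nw^m$); $0^0=1$. *)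

theory Defs
  imports Complex_Main "HOL-Library.Extended_Nat"
begin

text \<open>The quotient \<open>\<lfloor>j / r\<rfloor>\<close>, with \<open>\<lfloor>j / 0\<rfloor> = \<infinity>\<close>.\<close>

definition floor_quot :: "nat \<Rightarrow> nat \<Rightarrow> enat" where
  "floor_quot j r = (if r = 0 then \<infinity> else enat (j div r))"

text \<open>The sum over \<open>0 \<le> k \<le> K\<close>; for \<open>K = \<infinity>\<close> it is the value of the infinite series.\<close>

definition sum_upto :: "enat \<Rightarrow> (nat \<Rightarrow> complex) \<Rightarrow> complex" where
  "sum_upto K f = (case K of enat N \<Rightarrow> (\<Sum>k=0..N. f k) | \<infinity> \<Rightarrow> (\<Sum>k. f k))"

text \<open>\<open>hermite_H p q n m z w \<gamma>\<close> is $H_{n,m}^{(p,q)}(z,w|\gamma)$. Every \<open>k\<close> in the range of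
  summation satisfies \<open>p * k \<le> n\<close> and \<open>q * k \<le> m\<close>, so the subtractions never truncate.\<close>

definition hermite_H ::
  "nat \<Rightarrow> nat \<Rightarrow> nat \<Rightarrow> nat \<Rightarrow> complex \<Rightarrow> complex \<Rightarrow> complex \<Rightarrow> complex" where
  "hermite_H p q n m z w \<gamma> =
     fact n * fact m *
     sum_upto (min (floor_quot n p) (floor_quot m q))
       (\<lambda>k. \<gamma> ^ k / fact k * (z ^ (n - p * k) / fact (n - p * k))
              * (w ^ (m - q * k) / fact (m - q * k)))"

lemma le_floor_quot_iff: "enat k \<le> floor_quot j r \<longleftrightarrow> r * k \<le> j"
  by (auto simp: floor_quot_def less_eq_div_iff_mult_less_eq mult.commute)

lemma hermite_H_0_0: "hermite_H 0 0 n m z w \<gamma> = exp \<gamma> * z ^ n * w ^ m"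
proof -
  have "(\<lambda>k. \<gamma> ^ k / fact k) sums exp \<gamma>"
    using exp_converges[of \<gamma>] by (simp add: scaleR_conv_of_real field_simps)
  then have "(\<lambda>k. \<gamma> ^ k / fact k * (z ^ n / fact n) * (w ^ m / fact m)) sums
      (exp \<gamma> * (z ^ n / fact n) * (w ^ m / fact m))"
    by (intro sums_mult2)
  then show ?thesis
    by (simp add: hermite_H_def sum_upto_def floor_quot_def sums_iff)
qed

end

theory Submission
  imports Defs
begin

text \<open>
  Substituting the definition of $H^{(p,q)}$ and collecting the terms with \<open>s = k + l\<close>, where \<open>l\<close> is
  the inner summation index, leaves the coefficient
  $\frac{1}{s!}\sum_k \binom{s}{k}\binom{k}{j}(-1)^{k-j}$, which is $1/s!$ for \<open>j = s\<close> and
  \<open>0\<close> otherwise; so \<open>n - j - p * s\<close> becomes \<open>n - (p + 1) * s\<close>. For \<open>p = q = 0\<close> the outer sum is a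
  finite combination of shifted exponential series in $-\gamma$, which cancel $e^\gamma$.
\<close>

text \<open>Only \<open>k \<ge> j\<close> contributes. Putting \<open>k = i + j\<close> turns each
  weight into \<open>(s - j) choose i\<close> over \<open>fact j * fact (s - j)\<close>, leaving the
  alternating sum of a row of Pascal's triangle, which vanishes unless that row is row 0.\<close>

lemma sum_binomial_inversion_fact:
  "(\<Sum>k\<le>s. of_nat (k choose j) * (-1) ^ (k - j) / (fact k * fact (s - k))) =
     (if j = s then 1 / fact s else (0 :: 'a :: field_char_0))"
proof (cases "j \<le> s")
  case True
  have "(\<Sum>k\<le>s. of_nat (k choose j) * (-1) ^ (k - j) / (fact k * fact (s - k))) =
      (\<Sum>k\<in>{j..s}. of_nat (k choose j) * (-1) ^ (k - j) / (fact k * fact (s - k)) :: 'a)"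
    by (rule sum.mono_neutral_right) auto
  also have "\<dots> = (\<Sum>i\<le>s - j. of_nat ((i + j) choose j) * (-1) ^ i / (fact (i + j) * fact (s - j - i)))"
    by (rule sum.reindex_bij_witness[where i = "\<lambda>i. i + j" and j = "\<lambda>k. k - j"])
      (use True in auto)
  also have "\<dots> = (\<Sum>i\<le>s - j. (-1) ^ i * of_nat ((s - j) choose i) / (fact j * fact (s - j)))"
    by (intro sum.cong refl) (simp add: binomial_fact field_simps)
  also have "\<dots> = (\<Sum>i\<le>s - j. (-1) ^ i * of_nat ((s - j) choose i)) / (fact j * fact (s - j))"
    by (simp add: sum_divide_distrib)
  also have "\<dots> = (if j = s then 1 / fact s else 0)"
    using True choose_alternating_sum[of "s - j", where 'a = 'a] by (cases "j = s") auto
  finally show ?thesis .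
qed (auto intro!: sum.neutral)

lemma min_floor_quot_eq_infinity_iff:
  "min (floor_quot n p) (floor_quot m q) = \<infinity> \<longleftrightarrow> p = 0 \<and> q = 0"
  by (auto simp: floor_quot_def min_def)

lemma index_le_add:
  fixes p q s n m :: nat
  assumes "p \<noteq> 0 \<or> q \<noteq> 0" and "p * s \<le> n" and "q * s \<le> m"
  shows "s \<le> n + m"
proof -
  have "s \<le> p * s \<or> s \<le> q * s"
    using assms(1) by auto
  then show ?thesis
    using assms(2,3) by linarith
qed

text \<open>Replaces an upper limit depending on all the parameters by a fixed \<open>N\<close> and
  an indicator, so that sums can be interchanged. As any \<open>N \<ge> n + m\<close> is allowed,
  one \<open>N\<close> also serves the inner polynomials, whose indices are smaller.\<close>

lemma sum_upto_min_floor_quot: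
  assumes "p \<noteq> 0 \<or> q \<noteq> 0" and "n + m \<le> N"
  shows "sum_upto (min (floor_quot n p) (floor_quot m q)) f =
    (\<Sum>k\<le>N. if p * k \<le> n \<and> q * k \<le> m then f k else 0)"
proof -
  obtain L where L: "min (floor_quot n p) (floor_quot m q) = enat L"
    using assms(1) min_floor_quot_eq_infinity_iff[of n p m q] by auto
  have le_L_iff: "k \<le> L \<longleftrightarrow> p * k \<le> n \<and> q * k \<le> m" for k
  proof -
    have "enat k \<le> enat L \<longleftrightarrow> p * k \<le> n \<and> q * k \<le> m"
      unfolding L[symmetric] by (simp add: le_floor_quot_iff)
    then show ?thesis
      by simp
  qed
  then have "L \<le> N"
    using index_le_add[OF assms(1), of L n m] assms(2) by force
  then have "(\<Sum>k\<in>{0..L}. f k) = (\<Sum>k\<le>N. if k \<le> L then f k else 0)"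
    by (intro sum.mono_neutral_cong_left) auto
  then show ?thesis
    by (simp add: L sum_upto_def le_L_iff)
qed

lemma hermite_H_eq_sum:
  assumes "p \<noteq> 0 \<or> q \<noteq> 0" and "n + m \<le> N"
  shows "hermite_H p q n m z w \<gamma> / (fact n * fact m) =
    (\<Sum>k\<le>N. \<gamma> ^ k / fact k *
      (if p * k \<le> n \<and> q * k \<le> m
       then z ^ (n - p * k) / fact (n - p * k) * (w ^ (m - q * k) / fact (m - q * k)) else 0))"
  unfolding hermite_H_def sum_upto_min_floor_quot[OF assms]
  by (auto simp: mult_ac intro!: sum.cong)

lemma sum_atMost_shift_eq_triangle:
  fixes f :: "nat \<Rightarrow> nat \<Rightarrow> 'a :: comm_monoid_add"
  assumes "\<And>k l. k + l > N \<Longrightarrow> f k l = 0"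
  shows "(\<Sum>k\<le>N. \<Sum>l\<le>N. f k l) = (\<Sum>s\<le>N. \<Sum>k\<le>s. f k (s - k))"
proof -
  have "(\<Sum>k\<le>N. \<Sum>l\<le>N. f k l) = (\<Sum>(k, l)\<in>{..N} \<times> {..N}. f k l)"
    by (simp add: sum.cartesian_product)
  also have "\<dots> = (\<Sum>(k, l)\<in>{(k, l). k + l \<le> N}. f k l)"
    using assms by (intro sum.mono_neutral_right) (auto intro: leI)
  finally show ?thesis
    by (simp add: sum.triangle_reindex_eq)
qed

text \<open>The algebraic core: \<open>g\<close> sees \<open>k\<close> and \<open>l\<close> only
  through \<open>s = k + l\<close>, and the powers of \<open>x\<close> merge to
  \<open>x ^ s\<close>. Hence the sum over \<open>k\<close> for fixed \<open>s\<close> acts on the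
  weights alone, and the inversion formula keeps only \<open>j = s\<close>.\<close>

lemma sum_binomial_convolution:
  fixes g :: "nat \<Rightarrow> nat \<Rightarrow> 'a :: field_char_0"
  assumes "\<And>j s. s > N \<Longrightarrow> g j s = 0"
  shows "(\<Sum>k\<le>N. \<Sum>j\<le>k. of_nat (k choose j) * (x ^ k / fact k) * (-1) ^ (k - j) *
            (\<Sum>l\<le>N. x ^ l / fact l * g j (k + l))) =
         (\<Sum>s\<le>N. x ^ s / fact s * g s s)"
proof -
  define c :: "nat \<Rightarrow> nat \<Rightarrow> 'a" where "c j k = of_nat (k choose j) * (-1) ^ (k - j)" for j k
  have "(\<Sum>k\<le>N. \<Sum>j\<le>k. of_nat (k choose j) * (x ^ k / fact k) * (-1) ^ (k - j) *
            (\<Sum>l\<le>N. x ^ l / fact l * g j (k + l))) =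
        (\<Sum>k\<le>N. \<Sum>j\<le>N. \<Sum>l\<le>N. c j k / (fact k * fact l) * x ^ (k + l) * g j (k + l))"
  \<comment> \<open>Since \<open>k choose j\<close> is 0 for \<open>j > k\<close>, the range of
    \<open>j\<close> may be extended to \<open>N\<close>, making it independent of
    \<open>k\<close>.\<close>
  proof (rule sum.cong[OF refl])
    fix k assume "k \<in> {..N}"
    then show "(\<Sum>j\<le>k. of_nat (k choose j) * (x ^ k / fact k) * (-1) ^ (k - j) *
            (\<Sum>l\<le>N. x ^ l / fact l * g j (k + l))) =
        (\<Sum>j\<le>N. \<Sum>l\<le>N. c j k / (fact k * fact l) * x ^ (k + l) * g j (k + l))"
      by (intro sum.mono_neutral_cong_left ballI)
        (simp_all add: c_def sum_distrib_left sum_divide_distrib binomial_eq_0 power_add mult_ac)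
  qed
  also have "\<dots> = (\<Sum>j\<le>N. \<Sum>k\<le>N. \<Sum>l\<le>N. c j k / (fact k * fact l) * x ^ (k + l) * g j (k + l))"
    by (rule sum.swap)
  also have "\<dots> = (\<Sum>j\<le>N. \<Sum>s\<le>N. \<Sum>k\<le>s. c j k / (fact k * fact (s - k)) * x ^ s * g j s)"
    by (rule sum.cong[OF refl], subst sum_atMost_shift_eq_triangle)
      (auto simp: assms intro!: sum.cong)
  also have "\<dots> = (\<Sum>j\<le>N. \<Sum>s\<le>N. if j = s then x ^ s / fact s * g j s else 0)"
  proof (intro sum.cong refl)
    fix j s :: nat
    have "(\<Sum>k\<le>s. c j k / (fact k * fact (s - k)) * x ^ s * g j s) =
        (\<Sum>k\<le>s. c j k / (fact k * fact (s - k))) * (x ^ s * g j s)"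
      by (simp add: sum_distrib_right mult.assoc)
    then show "(\<Sum>k\<le>s. c j k / (fact k * fact (s - k)) * x ^ s * g j s) =
        (if j = s then x ^ s / fact s * g j s else 0)"
      by (simp add: c_def sum_binomial_inversion_fact)
  qed
  also have "\<dots> = (\<Sum>s\<le>N. x ^ s / fact s * g s s)"
    by (intro sum.cong refl) simp
  finally show ?thesis .
qed

text \<open>The first \<open>j\<close> terms vanish, and the remaining ones are
  \<open>x ^ j / fact j\<close> times the exponential series of \<open>- x\<close>.\<close>

lemma sums_binomial_exp_alternating:
  fixes x :: complex
  shows "(\<lambda>k. of_nat (k choose j) * (x ^ k / fact k) * (-1) ^ (k - j)) sums
    (x ^ j / fact j * exp (- x))"
proof -
  have "(\<lambda>i. x ^ j / fact j * ((- x) ^ i / fact i)) sums (x ^ j / fact j * exp (- x))"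
    using exp_converges[of "- x"] by (intro sums_mult) (simp add: scaleR_conv_of_real field_simps)
  moreover have "of_nat ((i + j) choose j) * (x ^ (i + j) / fact (i + j)) * (-1) ^ (i + j - j) =
      x ^ j / fact j * ((- x) ^ i / fact i)" for i
    by (simp add: binomial_fact power_add power_minus[of x] field_simps)
  ultimately show ?thesis
    by (subst sums_zero_iff_shift[of j, symmetric]) auto
qed

theorem proposition6p9:
  fixes n m p q :: nat and z w \<gamma> :: complex
  shows "let K = min (floor_quot n p) (floor_quot m q);
             t = (\<lambda>k. \<Sum>j=0..k. of_nat (k choose j) * (\<gamma> ^ k / fact k) * (-1) ^ (k - j) *
                   (if j + p * k \<le> n
                    then hermite_H p q (n - j - p * k) (m - q * k) z w \<gamma>
                           / (fact (n - j - p * k) * fact (m - q * k))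
                    else 0))
         in (K = \<infinity> \<longrightarrow> summable t) \<and>
            hermite_H (p + 1) q n m z w \<gamma> = fact n * fact m * sum_upto K t"
proof -
  define K where "K = min (floor_quot n p) (floor_quot m q)"
  define t where "t = (\<lambda>k. \<Sum>j=0..k. of_nat (k choose j) * (\<gamma> ^ k / fact k) * (-1) ^ (k - j) *
                   (if j + p * k \<le> n
                    then hermite_H p q (n - j - p * k) (m - q * k) z w \<gamma>
                           / (fact (n - j - p * k) * fact (m - q * k))
                    else 0))"
  define N where "N = n + m"
  \<comment> \<open>On the diagonal \<open>j = s\<close> the exponent of \<open>z\<close> is
    \<open>n - s - p * s\<close>, that is \<open>n - (p + 1) * s\<close>: \<open>g s s\<close> is
    the term of the left-hand side.\<close>
  define g where "g j s = (if j + p * s \<le> n \<and> q * s \<le> m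
      then z ^ (n - j - p * s) / fact (n - j - p * s) * (w ^ (m - q * s) / fact (m - q * s))
      else 0)" for j s
  \<comment> \<open>As \<open>p + 1\<close> is nonzero, this sum is finite even for
    \<open>p = q = 0\<close>.\<close>
  have lhs: "hermite_H (p + 1) q n m z w \<gamma> / (fact n * fact m) =
      (\<Sum>s\<le>N. \<gamma> ^ s / fact s * g s s)"
    by (subst hermite_H_eq_sum[where N = N]) (auto simp: N_def g_def intro!: sum.cong)
  have "(K = \<infinity> \<longrightarrow> summable t) \<and> sum_upto K t = (\<Sum>s\<le>N. \<gamma> ^ s / fact s * g s s)"
  proof (cases "p = 0 \<and> q = 0")
    case True
    \<comment> \<open>The binomial kills \<open>j > k\<close> and \<open>g j 0\<close> kills
      \<open>j > n\<close>, so \<open>j\<close> can run up to \<open>N\<close> for every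
      \<open>k\<close>; \<open>t\<close> is then a finite combination of convergent series.\<close>
    have t: "t = (\<lambda>k. \<Sum>j\<le>N. of_nat (k choose j) * (\<gamma> ^ k / fact k) * (-1) ^ (k - j) *
        (exp \<gamma> * g j 0))"
    proof
      fix k
      show "t k = (\<Sum>j\<le>N. of_nat (k choose j) * (\<gamma> ^ k / fact k) * (-1) ^ (k - j) *
        (exp \<gamma> * g j 0))"
        unfolding t_def
        by (rule sum.mono_neutral_cong)
          (use True in \<open>auto simp: g_def N_def hermite_H_0_0\<close>)
    qed
    have "t sums (\<Sum>j\<le>N. \<gamma> ^ j / fact j * exp (- \<gamma>) * (exp \<gamma> * g j 0))"
      unfolding t by (intro sums_sum sums_mult2 sums_binomial_exp_alternating)
    also have "(\<Sum>j\<le>N. \<gamma> ^ j / fact j * exp (- \<gamma>) * (exp \<gamma> * g j 0)) =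
        (\<Sum>s\<le>N. \<gamma> ^ s / fact s * g s s)"
      using True by (intro sum.cong refl) (simp add: g_def exp_minus)
    finally show ?thesis
      using True by (simp add: K_def min_floor_quot_eq_infinity_iff sum_upto_def sums_iff floor_quot_def)
  next
    case False
    then have disj_pq: "p \<noteq> 0 \<or> q \<noteq> 0"
      by simp
    have g0: "g j s = 0" if "s > N" for j s
      using index_le_add[of p q s n m] that False by (auto simp: g_def N_def)
    define u where "u k = (\<Sum>j\<le>k. of_nat (k choose j) * (\<gamma> ^ k / fact k) * (-1) ^ (k - j) *
        (\<Sum>l\<le>N. \<gamma> ^ l / fact l * g j (k + l)))" for k
    \<comment> \<open>The restriction on \<open>k\<close> matters: for \<open>q * k > m\<close> the
      subtraction \<open>m - q * k\<close> in \<open>t\<close> truncates to 0, while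
      \<open>u k\<close> vanishes.\<close>
    have tu: "t k = u k" if k: "p * k \<le> n" "q * k \<le> m" for k
      unfolding t_def u_def atLeast0AtMost
    proof (intro sum.cong refl arg_cong2[where f = "(*)"])
      fix j
      show "(if j + p * k \<le> n
              then hermite_H p q (n - j - p * k) (m - q * k) z w \<gamma>
                     / (fact (n - j - p * k) * fact (m - q * k))
              else 0) = (\<Sum>l\<le>N. \<gamma> ^ l / fact l * g j (k + l))"
      proof (cases "j + p * k \<le> n")
        case True
        \<comment> \<open>An index \<open>l\<close> is admissible for the inner polynomial exactly
          when \<open>k + l\<close> is admissible for \<open>g j\<close>.\<close>
        have "p * l \<le> n - j - p * k \<and> q * l \<le> m - q * k \<longleftrightarrow>
            j + p * (k + l) \<le> n \<and> q * (k + l) \<le> m" for l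
          using True k by (auto simp: algebra_simps)
        moreover have "n - j - p * k - p * l = n - j - p * (k + l)"
          "m - q * k - q * l = m - q * (k + l)" for l
          by (simp_all add: algebra_simps)
        ultimately show ?thesis
          using True False
          by (subst hermite_H_eq_sum[where N = N]) (auto simp: N_def g_def intro!: sum.cong)
      qed (auto simp: g_def algebra_simps)
    qed
    have u0: "u k = 0" if "\<not> (p * k \<le> n \<and> q * k \<le> m)" for k
      using that by (auto simp: u_def g_def algebra_simps)
    \<comment> \<open>The summability claim is vacuous in this case.\<close>
    have K: "K \<noteq> \<infinity>"
      using False by (simp add: K_def min_floor_quot_eq_infinity_iff)
    have "sum_upto K t = (\<Sum>k\<le>N. u k)"
      unfolding K_def sum_upto_min_floor_quot[OF disj_pq eq_refl[OF N_def[symmetric]]]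
      using tu u0 by (intro sum.cong) auto
    also have "\<dots> = (\<Sum>s\<le>N. \<gamma> ^ s / fact s * g s s)"
      unfolding u_def using g0 by (rule sum_binomial_convolution)
    finally show ?thesis
      using K by blast
  qed
  with lhs show ?thesis
    unfolding Let_def K_def[symmetric] t_def[symmetric] by (simp add: field_simps)
qed

end
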